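(* We have $$\liminf_{\Delta\to\infty}\frac{h_3(\Delta)}{\Delta^3}\ge \frac{253}{225}.$$ Equivalently, for every $0<\varepsilon<28/225$ and all sufficiently large $\Delta$ (depending on $\varepsilon$), we have $$h_3(\Delta)>(1+\varepsilon)\Delta^3.$$
   Context: All graphs are finite and simple. $\Delta(G)$ is the maximum degree of $G$. $L(G)$ is the line graph of $G$. For a positive integer $k$, the $k$-th power $F^k$ of a graph $F$ has vertex set $V(F)$, and two distinct vertices are adjacent in $F^k$ if and only if they are at distance at most $k$ in $F$. For positive integers $\Delta$ and $t$, the integer $h_t(\Delta)$ is defined by $$h_t(\Delta)-1:=\max_G\{\,|E(G)| : \Delta(G)\le\Delta,\ L(G)^t \text{ is a complete graph}\,\}.$$ Equivalently, $h_t(\Delta)$ is the smallest integer such that any graph $G$ with at least $h_t(\Delta)$ edges and maximum degree $\Delta(G)\le\Delta$ contains two edges that are at distance at least $t+1$ as vertices of $L(G)$ (the distance being infinite if they lie in different components). In the limit, $\Delta$ ranges over the positive integers. *)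

theory Defs
  imports Complex_Main "HOL-Library.Extended_Nat" "HOL-Library.Extended_Real"
begin

text \<open>An undirected edge is the two-element set of its ends.\<close>

record 'a ugraph =
  verts :: "'a set"
  edges :: "'a set set"

definition simple_graph :: "'a ugraph \<Rightarrow> bool" where
  "simple_graph G \<longleftrightarrow> finite (verts G) \<and> edges G \<subseteq> {e. e \<subseteq> verts G \<and> card e = 2}"

definition degree :: "'a ugraph \<Rightarrow> 'a \<Rightarrow> nat" where
  "degree G v = card {e \<in> edges G. v \<in> e}"

text \<open>The inserted 0 only matters for the graph without vertices.\<close>

definition max_degree :: "'a ugraph \<Rightarrow> nat" where
  "max_degree G = Max (insert 0 (degree G ` verts G))"

definition adj :: "'a ugraph \<Rightarrow> ('a \<times> 'a) set" where
  "adj G = {(u, v). {u, v} \<in> edges G}"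

text \<open>
  The relation \<open>adj G ^^ n\<close> relates the ends of walks of length \<open>n\<close>. Since \<open>Inf {} = \<infinity>\<close> in
  \<^typ>\<open>enat\<close>, vertices in different components are at infinite distance.
\<close>

definition gdist :: "'a ugraph \<Rightarrow> 'a \<Rightarrow> 'a \<Rightarrow> enat" where
  "gdist G u v = Inf {enat n | n. (u, v) \<in> adj G ^^ n}"

definition line_graph :: "'a ugraph \<Rightarrow> 'a set ugraph" where
  "line_graph G = \<lparr>verts = edges G,
     edges = {{e, f} | e f. e \<in> edges G \<and> f \<in> edges G \<and> e \<noteq> f \<and> e \<inter> f \<noteq> {}}\<rparr>"

definition graph_power :: "'a ugraph \<Rightarrow> nat \<Rightarrow> 'a ugraph" where
  "graph_power G k = \<lparr>verts = verts G,
     edges = {{u, v} | u v. u \<in> verts G \<and> v \<in> verts G \<and> u \<noteq> v \<and> gdist G u v \<le> enat k}\<rparr>"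

definition complete_graph :: "'a ugraph \<Rightarrow> bool" where
  "complete_graph G \<longleftrightarrow> (\<forall>u\<in>verts G. \<forall>v\<in>verts G. u \<noteq> v \<longrightarrow> {u, v} \<in> edges G)"

text \<open>
  Every finite graph is isomorphic to one whose vertices are natural numbers, so it suffices to
  let \<open>G\<close> range over those.
\<close>

definition edge_counts :: "nat \<Rightarrow> nat \<Rightarrow> nat set" where
  "edge_counts t D = {card (edges G) | G :: nat ugraph.
     simple_graph G \<and> max_degree G \<le> D \<and> complete_graph (graph_power (line_graph G) t)}"

definition h :: "nat \<Rightarrow> nat \<Rightarrow> nat" where
  "h t D = Max (edge_counts t D) + 1"

text \<open>The set of edge counts is finite and nonempty, so the maximum exists.\<close>

lemma edge_counts_nonempty: "edge_counts t D \<noteq> {}"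
proof -
  have "card (edges \<lparr>verts = {} :: nat set, edges = {}\<rparr>) \<in> edge_counts t D"
    unfolding edge_counts_def
    by (rule CollectI, rule exI[of _ "\<lparr>verts = {} :: nat set, edges = {}\<rparr>"])
       (simp add: simple_graph_def max_degree_def complete_graph_def graph_power_def
          line_graph_def)
  then show ?thesis by blast
qed

lemma gdist_le_walk:
  assumes "gdist G u v \<le> enat k"
  obtains n where "n \<le> k" "(u, v) \<in> adj G ^^ n"
proof -
  have "gdist G u v < enat (Suc k)"
    using assms by (rule order.strict_trans1) simp
  then show ?thesis
    unfolding gdist_def Inf_less_iff using that by (auto simp: less_Suc_eq_le)
qed

lemma finite_edge_counts: "finite (edge_counts t D)"
proof -
  have "card (edges G) \<le> (2 * D + 1) ^ t"
    if G: "simple_graph G" "max_degree G \<le> D"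
      "complete_graph (graph_power (line_graph G) t)" for G :: "nat ugraph"
  proof (cases "edges G = {}")
    case False
    then obtain e0 where e0: "e0 \<in> edges G" by blast
    have finV: "finite (verts G)" using G(1) by (simp add: simple_graph_def)
    have finE: "finite (edges G)"
      by (rule finite_subset[of _ "Pow (verts G)"]) (use G(1) finV in \<open>auto simp: simple_graph_def\<close>)
    have deg: "card {f \<in> edges G. v \<in> f} \<le> D" if "v \<in> verts G" for v
    proof -
      have "degree G v \<le> max_degree G"
        unfolding max_degree_def using finV that by (intro Max_ge) auto
      then show ?thesis using G(2) by (simp add: degree_def)
    qed
    define N where "N e = insert e {f \<in> edges G. e \<inter> f \<noteq> {}}" for e
    have finN: "finite (N e)" for e using finE by (simp add: N_def)
    have cardN: "card (N e) \<le> 2 * D + 1" if e: "e \<in> edges G" for e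
    proof -
      have "e \<subseteq> verts G" "card e = 2" using e G(1) by (auto simp: simple_graph_def)
      then obtain a b where ab: "e = {a, b}" "a \<in> verts G" "b \<in> verts G"
        by (auto simp: card_2_iff)
      have "{f \<in> edges G. e \<inter> f \<noteq> {}} = {f \<in> edges G. a \<in> f} \<union> {f \<in> edges G. b \<in> f}"
        using ab by auto
      then have "card {f \<in> edges G. e \<inter> f \<noteq> {}} \<le> D + D"
        using card_Un_le[of "{f \<in> edges G. a \<in> f}" "{f \<in> edges G. b \<in> f}"]
          deg[OF ab(2)] deg[OF ab(3)] by simp
      then show ?thesis
        unfolding N_def using card_insert_le_m1 finE by (simp add: card_insert_if)
    qed
    define B where "B = rec_nat {e0} (\<lambda>_ S. \<Union> (N ` S))"
    have B0: "B 0 = {e0}" and BS: "B (Suc k) = \<Union> (N ` B k)" for k by (simp_all add: B_def)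
    have BE: "B k \<subseteq> edges G" for k
      by (induction k) (use e0 in \<open>auto simp: B0 BS N_def\<close>)
    have cardB: "card (B k) \<le> (2 * D + 1) ^ k" for k
    proof (induction k)
      case (Suc k)
      have "finite (B k)" using BE finE finite_subset by blast
      then have "card (B (Suc k)) \<le> (\<Sum>e\<in>B k. card (N e))"
        unfolding BS by (rule card_UN_le)
      also have "\<dots> \<le> card (B k) * (2 * D + 1)"
        using sum_bounded_above[of "B k" "\<lambda>e. card (N e)" "2 * D + 1"] cardN BE by auto
      also have "\<dots> \<le> (2 * D + 1) ^ k * (2 * D + 1)"
        using Suc by (rule mult_le_mono1)
      finally show ?case by (simp add: mult.commute)
    qed (simp add: B0)
    have mono: "B m \<subseteq> B n" if "m \<le> n" for m n
      using that by (rule lift_Suc_mono_le[rotated]) (auto simp: BS N_def)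
    have walk: "f \<in> B n" if "(e0, f) \<in> adj (line_graph G) ^^ n" for f n
      using that
    proof (induction n arbitrary: f)
      case (Suc n)
      then obtain g where g: "(e0, g) \<in> adj (line_graph G) ^^ n" "(g, f) \<in> adj (line_graph G)"
        by auto
      then have "f \<in> N g" by (auto simp: adj_def line_graph_def N_def doubleton_eq_iff)
      then show ?case using Suc.IH[OF g(1)] by (auto simp: BS)
    qed (simp add: B0)
    have "edges G \<subseteq> B t"
    proof
      fix f assume f: "f \<in> edges G"
      show "f \<in> B t"
      proof (cases "f = e0")
        case True
        then show ?thesis using mono[of 0 t] by (auto simp: B0)
      next
        case False
        then have "{e0, f} \<in> edges (graph_power (line_graph G) t)"
          and "{f, e0} \<in> edges (graph_power (line_graph G) t)"
          using G(3) e0 f by (auto simp: complete_graph_def graph_power_def line_graph_def)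
        then have "gdist (line_graph G) e0 f \<le> enat t \<or> gdist (line_graph G) f e0 \<le> enat t"
          by (auto simp: graph_power_def doubleton_eq_iff)
        moreover have "(u, w) \<in> adj (line_graph G) ^^ n" if "(w, u) \<in> adj (line_graph G) ^^ n" for u w n
          using that
        proof (induction n arbitrary: u)
          case (Suc n)
          then obtain g where g: "(w, g) \<in> adj (line_graph G) ^^ n" "(g, u) \<in> adj (line_graph G)"
            by auto
          from g(2) have "(u, g) \<in> adj (line_graph G)" by (simp add: adj_def insert_commute)
          then show ?case using Suc.IH[OF g(1)] by (rule relpow_Suc_I2)
        qed simp
        ultimately obtain n where "n \<le> t" "(e0, f) \<in> adj (line_graph G) ^^ n"
          by (meson gdist_le_walk)
        then show ?thesis using walk mono by blast
      qed
    qed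
    moreover have "finite (B t)" using BE finE finite_subset by blast
    ultimately have "card (edges G) \<le> card (B t)" by (intro card_mono)
    then show ?thesis using cardB[of t] by linarith
  qed simp
  then have "edge_counts t D \<subseteq> {..(2 * D + 1) ^ t}"
    by (auto simp: edge_counts_def)
  then show ?thesis using finite_subset by blast
qed

end

theory Submission
  imports Defs "HOL-Algebra.Algebraic_Closure_Type"
    "HOL-Analysis.Kronecker_Approximation_Theorem" "HOL-Real_Asymp.Real_Asymp"
begin

text \<open>
  The constant \<open>253 / 225\<close> comes from products of one exceptional graph with projective planes.

  Two edges are at distance at most 3 in the line graph if an end of the one and an end of the other
  have a common neighbour. Suppose that this holds for any two edges of a graph \<open>H\<close>, and let \<open>P\<close> be a
  graph, possibly with loops, in which any two vertices, equal or not, have a common neighbour. Then the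
  tensor product of \<open>H\<close> and \<open>P\<close> inherits the property of \<open>H\<close>: common neighbours are found in each
  coordinate separately (\<open>ends_linked_tensor\<close>). The polarity graph of the projective plane of order \<open>q\<close>
  is such a \<open>P\<close>, since any two lines meet. Its degrees are \<open>q + 1\<close>, and it has more than \<open>q ^ 3\<close> arcs. Thus
  if \<open>H\<close> has \<open>m\<close> edges and maximum degree \<open>d\<close>, the product has at least \<open>m * q ^ 3\<close> edges and maximum degree at
  most \<open>d * (q + 1)\<close>, and the ratio \<open>m / d ^ 3\<close> is realised in the limit.

  For \<open>H\<close> the truncated Witt graph is taken, the 506 octads on 24 points that miss a given point, with
  disjointness as adjacency. It is regular of degree 15, so it has 3795 edges, and
  \<open>3795 / 15 ^ 3 = 253 / 225\<close>. Any two octads either meet in exactly 2 points, or are disjoint, or have a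
  common neighbour. If two edges violated the condition, then the two disjoint pairs of octads would
  meet in \<open>4 * 2\<close> points and so cover \<open>32 - 8 = 24\<close> points, while only 23 are available
  (\<open>ends_linked_disjointness\<close>).

  The degree bound \<open>D\<close> is arbitrary, so orders with sufficiently small gaps are needed. Multiplying \<open>H\<close>
  with two planes, of orders \<open>2 ^ a\<close> and \<open>3 ^ b\<close>, makes their product \<open>2 ^ a * 3 ^ b\<close> available in the role of
  \<open>q\<close>. Since \<open>ln 2 / ln 3\<close> is irrational, such numbers occur between \<open>c * Y\<close> and \<open>Y\<close> for every \<open>c < 1\<close> and
  every large \<open>Y\<close> (\<open>eventually_2_3_smooth_below\<close>).
\<close>

section \<open>Symmetric relations as graphs\<close>

text \<open>
  A relation \<open>R\<close>, symmetric and irreflexive, stands for the graph whose edges are the unordered pairs of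
  related elements. If some end of the one edge and some end of the other have a common neighbour,
  then the two edges are at distance at most 3 in the line graph: the two edges through the common
  neighbour lie between them. Asking for a walk of length exactly 2 costs little, since adjacent ends
  provide one, and such walks survive the products below, whereas shorter ones do not.
\<close>

definition ends_linked :: "'a rel \<Rightarrow> bool" where
  "ends_linked R \<longleftrightarrow> (\<forall>a b u v. (a, b) \<in> R \<longrightarrow> (u, v) \<in> R \<longrightarrow> (\<exists>x\<in>{a, b}. \<exists>y\<in>{u, v}. (x, y) \<in> R O R))"

text \<open>
  The reflexive closure absorbs the degenerate cases in which the path between two edges repeats an
  edge.
\<close>

lemma line_graph_step:
  assumes "e \<in> edges G" "f \<in> edges G" "e \<inter> f \<noteq> {}"
  shows "(e, f) \<in> (adj (line_graph G))\<^sup>="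
  using assms by (auto simp: adj_def line_graph_def)

lemma gdist_le_3:
  assumes "(a, b) \<in> (adj G)\<^sup>=" "(b, c) \<in> (adj G)\<^sup>=" "(c, d) \<in> (adj G)\<^sup>="
  shows "gdist G a d \<le> enat 3"
proof -
  have "(a, d) \<in> (adj G)\<^sup>= ^^ 3"
    using assms by (auto simp: numeral_3_eq_3)
  then have "(a, d) \<in> (\<Union>n\<le>3. adj G ^^ n)"
    by (auto simp: numeral_3_eq_3 atMost_Suc)
  then obtain n where "n \<le> 3" "(a, d) \<in> adj G ^^ n"
    by blast
  then have "gdist G a d \<le> enat n"
    unfolding gdist_def by (intro Inf_lower) auto
  also have "\<dots> \<le> enat 3"
    using \<open>n \<le> 3\<close> by simp
  finally show ?thesis .
qed

lemma card_le_2_card_unordered: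
  assumes "finite R" "inj_on f (Field R)"
  shows "card R \<le> 2 * card ((\<lambda>(a, b). {f a, f b}) ` R)"
proof -
  let ?\<phi> = "\<lambda>(a, b). {f a, f b}"
  have fibre: "card {r \<in> R. ?\<phi> r = e} \<le> 2" if e: "e \<in> ?\<phi> ` R" for e
  proof -
    obtain a b where "(a, b) \<in> R" "e = {f a, f b}"
      using e by auto
    moreover have "f c = f d \<longleftrightarrow> c = d" if "c \<in> Field R" "d \<in> Field R" for c d
      using that assms(2) by (auto dest: inj_onD)
    ultimately have "{r \<in> R. ?\<phi> r = e} \<subseteq> {(a, b), (b, a)}"
      by (auto simp: doubleton_eq_iff FieldI1 FieldI2)
    then have "card {r \<in> R. ?\<phi> r = e} \<le> card {(a, b), (b, a)}"
      by (intro card_mono) auto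
    also have "\<dots> \<le> 2"
      using card_insert_le_m1[of 2 "{(b, a)}" "(a, b)"] by simp
    finally show ?thesis .
  qed
  have "card (\<Union>e\<in>?\<phi> ` R. {r \<in> R. ?\<phi> r = e}) \<le> (\<Sum>e\<in>?\<phi> ` R. card {r \<in> R. ?\<phi> r = e})"
    using assms(1) by (intro card_UN_le) simp
  moreover have "(\<Union>e\<in>?\<phi> ` R. {r \<in> R. ?\<phi> r = e}) = R"
    by blast
  ultimately have "card R \<le> (\<Sum>e\<in>?\<phi> ` R. card {r \<in> R. ?\<phi> r = e})"
    by (simp only:)
  also have "\<dots> \<le> card (?\<phi> ` R) * 2"
    using fibre sum_bounded_above[of "?\<phi> ` R" "\<lambda>e. card {r \<in> R. ?\<phi> r = e}" 2] by simp
  finally show ?thesis by simp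
qed

text \<open>
  The vertices are copied injectively into the natural numbers, where \<open>h\<close> looks for its graphs. The
  factor 2 appears because \<open>R\<close> contains every edge in both orientations.
\<close>

lemma card_less_2_h_3:
  assumes fin: "finite R" and "sym R" "irrefl R"
    and deg: "\<And>v. card (R `` {v}) \<le> D" and linked: "ends_linked R"
  shows "card R < 2 * h 3 D"
proof -
  have finF: "finite (Field R)"
    using fin by (rule finite_Field)
  obtain f :: "'a \<Rightarrow> nat" where f: "inj_on f (Field R)"
    using finite_imp_inj_to_nat_seg[OF finF] by blast
  have f_eq: "f c = f d \<longleftrightarrow> c = d" if "c \<in> Field R" "d \<in> Field R" for c d
    using f that by (auto dest: inj_onD)
  define G where "G = \<lparr>verts = f ` Field R, edges = (\<lambda>(a, b). {f a, f b}) ` R\<rparr>"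
  have edge: "{f a, f b} \<in> edges G" if "(a, b) \<in> R" for a b
    using that by (force simp: G_def)
  have "simple_graph G"
    unfolding simple_graph_def
  proof
    show "finite (verts G)"
      using finF by (simp add: G_def)
    show "edges G \<subseteq> {e. e \<subseteq> verts G \<and> card e = 2}"
    proof
      fix e assume "e \<in> edges G"
      then obtain a b where ab: "(a, b) \<in> R" "e = {f a, f b}"
        by (auto simp: G_def)
      then have "a \<in> Field R" "b \<in> Field R" "a \<noteq> b"
        using \<open>irrefl R\<close> by (auto intro: FieldI1 FieldI2 simp: irrefl_def)
      then show "e \<in> {e. e \<subseteq> verts G \<and> card e = 2}"
        using ab by (auto simp: G_def f_eq card_insert_if)
    qed
  qed
  have degree: "Defs.degree G v \<le> D" if v: "v \<in> verts G" for v
  proof -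
    obtain a where a: "a \<in> Field R" "v = f a"
      using v by (auto simp: G_def)
    have "{e \<in> edges G. v \<in> e} \<subseteq> (\<lambda>b. {f a, f b}) ` (R `` {a})"
    proof
      fix e assume "e \<in> {e \<in> edges G. v \<in> e}"
      then obtain c d where "(c, d) \<in> R" "e = {f c, f d}" "a = c \<or> a = d"
        using a by (auto simp: G_def f_eq FieldI1 FieldI2)
      moreover then have "(d, c) \<in> R"
        using \<open>sym R\<close> by (auto dest: symD)
      ultimately show "e \<in> (\<lambda>b. {f a, f b}) ` (R `` {a})"
        by auto
    qed
    moreover have finI: "finite (R `` {a})"
      using fin by (rule finite_Image)
    ultimately have "card {e \<in> edges G. v \<in> e} \<le> card (R `` {a})"
      by (meson card_image_le card_mono finite_imageI order_trans)
    then show ?thesis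
      using deg[of a] by (simp add: Defs.degree_def)
  qed
  then have "max_degree G \<le> D"
    unfolding max_degree_def using finF by (subst Max_le_iff) (auto simp: G_def)
  have "complete_graph (graph_power (line_graph G) 3)"
    unfolding complete_graph_def
  proof (intro ballI impI)
    fix e e' assume "e \<in> verts (graph_power (line_graph G) 3)"
      "e' \<in> verts (graph_power (line_graph G) 3)" "e \<noteq> e'"
    then have e: "e \<in> edges G" "e' \<in> edges G"
      by (auto simp: graph_power_def line_graph_def)
    then obtain a b u v where ab: "(a, b) \<in> R" "e = {f a, f b}"
      and uv: "(u, v) \<in> R" "e' = {f u, f v}"
      by (auto simp: G_def)
    obtain x y where "x \<in> {a, b}" "y \<in> {u, v}" "(x, y) \<in> R O R"
      using linked[unfolded ends_linked_def, rule_format, OF ab(1) uv(1)] by blast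
    then obtain c where "(x, c) \<in> R" "(c, y) \<in> R" "f x \<in> e" "f y \<in> e'"
      using ab uv by auto
    then have "gdist (line_graph G) e e' \<le> enat 3"
      using e by (intro gdist_le_3[of _ "{f x, f c}" _ "{f c, f y}"] line_graph_step edge) auto
    then show "{e, e'} \<in> edges (graph_power (line_graph G) 3)"
      using e \<open>e \<noteq> e'\<close> by (auto simp: graph_power_def line_graph_def)
  qed
  with \<open>simple_graph G\<close> \<open>max_degree G \<le> D\<close> have "card (edges G) \<in> edge_counts 3 D"
    by (auto simp: edge_counts_def)
  then have "card (edges G) < h 3 D"
    unfolding h_def using Max_ge[OF finite_edge_counts] by (simp add: less_Suc_eq_le)
  moreover have "card R \<le> 2 * card (edges G)"
    using card_le_2_card_unordered[OF fin f] by (simp add: G_def)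
  ultimately show ?thesis
    by simp
qed

section \<open>Tensor products\<close>

text \<open>
  The factor that is multiplied onto a graph to enlarge it has to link all pairs of vertices, because
  nothing is known about the second coordinates of the ends which the first factor offers. It may have
  loops: the product is loopless as soon as its first factor is.
\<close>

definition all_linked :: "'a rel \<Rightarrow> bool" where
  "all_linked S \<longleftrightarrow> Field S \<times> Field S \<subseteq> S O S"

definition tensor :: "'a rel \<Rightarrow> 'b rel \<Rightarrow> ('a \<times> 'b) rel" where
  "tensor R S = {((a, x), (b, y)) | a b x y. (a, b) \<in> R \<and> (x, y) \<in> S}"

lemma tensor_iff [simp]: "((a, x), (b, y)) \<in> tensor R S \<longleftrightarrow> (a, b) \<in> R \<and> (x, y) \<in> S"
  by (simp add: tensor_def)

lemma tensor_eq_image: "tensor R S = (\<lambda>((a, b), (x, y)). ((a, x), (b, y))) ` (R \<times> S)"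
  by (force simp: tensor_def)

text \<open>
  Degrees and numbers of arcs are both multiplicative. If \<open>S\<close> has degrees at most \<open>d\<close> and about \<open>d ^ 3\<close>
  arcs, then passing from \<open>R\<close> to \<open>tensor R S\<close> nearly preserves the number of arcs divided by the cube of
  the degree bound.
\<close>

lemma card_tensor: "card (tensor R S) = card R * card S"
  unfolding tensor_eq_image by (subst card_image) (auto simp: inj_on_def card_cartesian_product)

lemma finite_tensor: "finite R \<Longrightarrow> finite S \<Longrightarrow> finite (tensor R S)"
  unfolding tensor_eq_image by simp

lemma sym_tensor: "sym R \<Longrightarrow> sym S \<Longrightarrow> sym (tensor R S)"
  by (auto simp: sym_def)

lemma irrefl_tensor: "irrefl R \<Longrightarrow> irrefl (tensor R S)"
  by (auto simp: irrefl_def)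

lemma card_tensor_Image_le:
  assumes "\<And>a. card (R `` {a}) \<le> m" "\<And>x. card (S `` {x}) \<le> n"
  shows "card (tensor R S `` {p}) \<le> m * n"
proof -
  have "tensor R S `` {p} = R `` {fst p} \<times> S `` {snd p}"
    by (cases p) auto
  then show ?thesis
    using assms by (simp add: card_cartesian_product mult_le_mono)
qed

lemma Field_tensor: "Field (tensor R S) \<subseteq> Field R \<times> Field S"
  by (auto simp: Field_def)

lemma tensor_relcomp_I:
  assumes "(a, b) \<in> R O R" "(x, y) \<in> S O S"
  shows "((a, x), (b, y)) \<in> tensor R S O tensor R S"
  using assms by (auto intro: relcompI[of _ "(_, _)"])

lemma all_linked_tensor:
  assumes "all_linked R" "all_linked S"
  shows "all_linked (tensor R S)"
  unfolding all_linked_def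
proof clarify
  fix a x b y assume "(a, x) \<in> Field (tensor R S)" "(b, y) \<in> Field (tensor R S)"
  then show "((a, x), (b, y)) \<in> tensor R S O tensor R S"
    using assms Field_tensor[of R S] by (intro tensor_relcomp_I) (auto simp: all_linked_def)
qed

lemma ends_linked_tensor:
  assumes "ends_linked R" "all_linked S"
  shows "ends_linked (tensor R S)"
  unfolding ends_linked_def
proof (clarify)
  fix a b u v x y z w
  assume arcs: "((a, x), (b, y)) \<in> tensor R S" "((u, z), (v, w)) \<in> tensor R S"
  then obtain c d where cd: "c \<in> {a, b}" "d \<in> {u, v}" "(c, d) \<in> R O R"
    using assms(1)[unfolded ends_linked_def, rule_format, of a b u v] by auto
  have "x \<in> Field S" "y \<in> Field S" "z \<in> Field S" "w \<in> Field S"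
    using arcs by (auto intro: FieldI1 FieldI2)
  then have S: "(s, t) \<in> S O S" if "s \<in> {x, y}" "t \<in> {z, w}" for s t
    using that assms(2) by (auto simp: all_linked_def)
  show "\<exists>p\<in>{(a, x), (b, y)}. \<exists>q\<in>{(u, z), (v, w)}. (p, q) \<in> tensor R S O tensor R S"
    using cd S by (auto intro!: tensor_relcomp_I)
qed

section \<open>Polarity graphs of projective planes\<close>

text \<open>
  Fields of the orders in question are found inside algebraically closed types, hence fields enter as
  subsets. With the convention \<open>x / 0 = 0\<close> the closure under division also covers the divisor 0.
\<close>

definition subfield_set :: "'a::field set \<Rightarrow> bool" where
  "subfield_set F \<longleftrightarrow> (\<forall>x\<in>F. \<forall>y\<in>F. x - y \<in> F \<and> x * y \<in> F \<and> x / y \<in> F)"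

text \<open>
  The points of the projective plane: the affine ones, the point at infinity of the lines of a given
  finite slope, and the point at infinity of the vertical lines.
\<close>

datatype 'a point = Affine 'a 'a | Slope 'a | Vertical

text \<open>
  Conjugacy under a polarity. The polar line of \<open>Affine x y\<close> is the line with slope \<open>x\<close> and intercept
  \<open>- y\<close>, that of \<open>Slope c\<close> is the vertical line over \<open>c\<close>, and that of \<open>Vertical\<close> is the line at infinity.
  Symmetry of the equation \<open>y + y' = x * x'\<close> is what makes this a polarity.
\<close>

fun conj_points :: "'a::field point \<Rightarrow> 'a point \<Rightarrow> bool" where
  "conj_points (Affine x y) (Affine x' y') \<longleftrightarrow> y + y' = x * x'"
| "conj_points (Affine x y) (Slope c) \<longleftrightarrow> x = c"
| "conj_points (Slope c) (Affine x y) \<longleftrightarrow> x = c"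
| "conj_points (Slope c) Vertical \<longleftrightarrow> True"
| "conj_points Vertical (Slope c) \<longleftrightarrow> True"
| "conj_points Vertical Vertical \<longleftrightarrow> True"
| "conj_points (Affine x y) Vertical \<longleftrightarrow> False"
| "conj_points Vertical (Affine x y) \<longleftrightarrow> False"
| "conj_points (Slope c) (Slope d) \<longleftrightarrow> False"

definition polarity :: "'a::field set \<Rightarrow> 'a point rel" where
  "polarity F = {(p, q). set_point p \<subseteq> F \<and> set_point q \<subseteq> F \<and> conj_points p q}"

lemma conj_points_commute: "conj_points p q \<longleftrightarrow> conj_points q p"
  by (induction p q rule: conj_points.induct) (auto simp: algebra_simps)

lemma sym_polarity: "sym (polarity F)"
  by (auto simp: sym_def polarity_def conj_points_commute)

lemma polarity_Image:
  assumes "subfield_set F"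
  shows "polarity F `` {Affine x y} \<subseteq> insert (Slope x) ((\<lambda>z. Affine z (x * z - y)) ` F)"
    and "polarity F `` {Slope x} \<subseteq> insert Vertical ((\<lambda>z. Affine x z) ` F)"
    and "polarity F `` {Vertical} \<subseteq> insert Vertical (Slope ` F)"
proof -
  show "polarity F `` {Affine x y} \<subseteq> insert (Slope x) ((\<lambda>z. Affine z (x * z - y)) ` F)"
  proof
    fix p assume "p \<in> polarity F `` {Affine x y}"
    then show "p \<in> insert (Slope x) ((\<lambda>z. Affine z (x * z - y)) ` F)"
      by (cases p) (auto simp: polarity_def eq_diff_eq add.commute image_iff)
  qed
  show "polarity F `` {Slope x} \<subseteq> insert Vertical ((\<lambda>z. Affine x z) ` F)"
  proof
    fix p assume "p \<in> polarity F `` {Slope x}"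
    then show "p \<in> insert Vertical ((\<lambda>z. Affine x z) ` F)"
      by (cases p) (auto simp: polarity_def)
  qed
  show "polarity F `` {Vertical} \<subseteq> insert Vertical (Slope ` F)"
  proof
    fix p assume "p \<in> polarity F `` {Vertical}"
    then show "p \<in> insert Vertical (Slope ` F)"
      by (cases p) (auto simp: polarity_def)
  qed
qed

text \<open>
  The neighbours of a point are the points of its polar line, of which there are \<open>card F + 1\<close>.
\<close>

lemma card_polarity_Image_le:
  assumes "subfield_set F" "finite F"
  shows "card (polarity F `` {p}) \<le> card F + 1"
proof -
  have "card (insert q (f ` F)) \<le> card F + 1" for q :: "'a point" and f
    using card_insert_le_m1[of "card F + 1" "f ` F" q] card_image_le[OF assms(2), of f] by simp
  then have "card A \<le> card F + 1" if "A \<subseteq> insert q (f ` F)" for A and q :: "'a point" and f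
    using card_mono[OF _ that] assms(2) by (meson finite_imageI finite_insert le_trans)
  then show ?thesis
    using polarity_Image[OF assms(1)] by (cases p) blast+
qed

lemma finite_polarity:
  assumes "finite F"
  shows "finite (polarity F)"
proof -
  have "p \<in> insert Vertical (Slope ` F \<union> (\<lambda>(x, y). Affine x y) ` (F \<times> F))" if "set_point p \<subseteq> F" for p
    using that by (cases p) auto
  then have "polarity F \<subseteq> insert Vertical (Slope ` F \<union> (\<lambda>(x, y). Affine x y) ` (F \<times> F)) \<times>
      insert Vertical (Slope ` F \<union> (\<lambda>(x, y). Affine x y) ` (F \<times> F))"
    unfolding polarity_def by blast
  then show ?thesis
    by (rule finite_subset) (use assms in auto)
qed

text \<open>
  Arcs between affine points suffice for the leading term \<open>q ^ 3\<close>: in an affine arc the first end and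
  the abscissa of the second are free, and they determine the second ordinate.
\<close>

lemma card_polarity_ge:
  assumes "subfield_set F" "finite F"
  shows "card F ^ 3 \<le> card (polarity F)"
proof -
  let ?f = "\<lambda>(x, y, z). (Affine x y, Affine z (x * z - y))"
  have "?f ` (F \<times> F \<times> F) \<subseteq> polarity F"
    using assms(1) by (auto simp: polarity_def subfield_set_def)
  then have "card (?f ` (F \<times> F \<times> F)) \<le> card (polarity F)"
    using finite_polarity[OF assms(2)] by (rule card_mono[rotated])
  also have "card (?f ` (F \<times> F \<times> F)) = card F ^ 3"
    by (subst card_image) (auto simp: inj_on_def card_cartesian_product power3_eq_cube)
  finally show ?thesis .
qed

text \<open>
  Two lines of a projective plane always meet, and a point common to the polar lines of \<open>p\<close> and \<open>q\<close> is
  conjugate to both. For equal points any point of the polar line will do.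
\<close>

lemma all_linked_polarity:
  assumes F: "subfield_set F"
  shows "all_linked (polarity F)"
proof -
  have common: "\<exists>r. set_point r \<subseteq> F \<and> conj_points p r \<and> conj_points r q"
    if "set_point p \<subseteq> F" "set_point q \<subseteq> F" for p q
    using that
  proof (induction p q rule: conj_points.induct)
    case (1 x y x' y')
    show ?case
    proof (cases "x = x'")
      case True
      with 1 show ?thesis
        by (intro exI[of _ "Slope x"]) auto
    next
      case False
      let ?z = "(y - y') / (x - x')"
      have "conj_points (Affine x y) (Affine ?z (x * ?z - y))"
        "conj_points (Affine ?z (x * ?z - y)) (Affine x' y')"
        using False by (auto simp: field_simps)
      moreover have "?z \<in> F" "x * ?z - y \<in> F"
        using F 1 by (auto simp: subfield_set_def)
      ultimately show ?thesis
        by (intro exI[of _ "Affine ?z (x * ?z - y)"]) auto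
    qed
  next
    case (2 x y c)
    then show ?case
      using F by (intro exI[of _ "Affine c (x * c - y)"]) (auto simp: subfield_set_def)
  next
    case (3 c x y)
    then show ?case
      using F by (intro exI[of _ "Affine c (x * c - y)"]) (auto simp: subfield_set_def algebra_simps)
  next
    case (7 x y)
    then show ?case by (intro exI[of _ "Slope x"]) auto
  next
    case (8 x y)
    then show ?case by (intro exI[of _ "Slope x"]) auto
  qed (auto intro!: exI[of _ Vertical])
  have points: "set_point p \<subseteq> F" if "p \<in> Field (polarity F)" for p
    using that by (auto simp: polarity_def Field_def)
  show ?thesis
    unfolding all_linked_def
  proof clarify
    fix p q assume "p \<in> Field (polarity F)" "q \<in> Field (polarity F)"
    then obtain r where "(p, r) \<in> polarity F" "(r, q) \<in> polarity F"
      using common[of p q] points unfolding polarity_def by blast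
    then show "(p, q) \<in> polarity F O polarity F"
      by (rule relcompI)
  qed
qed

section \<open>Finite subfields of algebraically closed fields\<close>

text \<open>
  In characteristic \<open>p\<close>, raising to the power \<open>p ^ k\<close> is an endomorphism of the field.
\<close>

lemma subfield_set_frobenius_fixed:
  assumes "prime CHAR('a::field)"
  shows "subfield_set {x::'a. x ^ CHAR('a) ^ k = x}"
proof -
  have "(x - y) ^ CHAR('a) ^ k = x ^ CHAR('a) ^ k - y ^ CHAR('a) ^ k" for x y :: 'a
    using freshmans_dream'[OF assms refl, of "x - y" y k] by simp
  then show ?thesis
    by (auto simp: subfield_set_def power_mult_distrib power_divide)
qed

text \<open>
  The polynomial splits into linear factors, and a repeated factor would also divide the derivative.
\<close>

lemma card_roots_separable:
  fixes p :: "'a::alg_closed_field poly"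
  assumes "p \<noteq> 0" and sep: "\<And>x. poly p x = 0 \<Longrightarrow> poly (pderiv p) x \<noteq> 0"
  shows "card {x. poly p x = 0} = Polynomial.degree p"
proof -
  obtain A c where A: "size A = Polynomial.degree p" and p: "p = smult c (\<Prod>x\<in>#A. [:-x, 1:])"
    using alg_closed_imp_factorization[OF assms(1)] by blast
  have roots: "poly p x = 0 \<longleftrightarrow> x \<in># A" for x
    using assms(1) unfolding p by (auto simp: poly_prod_mset prod_mset_zero_iff)
  have "count A x \<le> 1" for x
  proof (rule ccontr)
    assume "\<not> count A x \<le> 1"
    then have "{#x, x#} \<subseteq># A"
      by (auto simp: subseteq_mset_def)
    then obtain B where "A = {#x, x#} + B"
      by (auto simp: mset_subset_eq_exists_conv)
    then have q: "p = [:-x, 1:] * ([:-x, 1:] * smult c (\<Prod>y\<in>#B. [:-y, 1:]))"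
      unfolding p by (simp only: image_mset_union image_mset_add_mset image_mset_empty
        prod_mset.add_mset prod_mset.union prod_mset.empty mult_smult_right mult_1_right mult.assoc)
    have "poly p x = 0"
      unfolding q by simp
    moreover have "poly (pderiv p) x = 0"
      unfolding q by (simp add: pderiv_mult pderiv_smult del: mult_pCons_left)
    ultimately show False
      using sep by blast
  qed
  then have "count A x = 1" if "x \<in># A" for x
    using that by (simp add: le_antisym Suc_leI)
  then have "size A = card (set_mset A)"
    by (simp add: size_multiset_overloaded_eq)
  moreover have "{x. poly p x = 0} = set_mset A"
    using roots by auto
  ultimately show ?thesis
    using A by simp
qed

text \<open>
  The fixed elements are the roots of \<open>X ^ n - X\<close> for \<open>n = CHAR('a) ^ k\<close>, whose derivative is \<open>- 1\<close> in
  characteristic dividing \<open>n\<close>. So the subfield has exactly \<open>n\<close> elements.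
\<close>

lemma card_frobenius_fixed:
  assumes "prime CHAR('a::alg_closed_field)" "k > 0"
  shows "card {x::'a. x ^ CHAR('a) ^ k = x} = CHAR('a) ^ k"
proof -
  let ?n = "CHAR('a) ^ k"
  have n: "?n > 1"
    using assms by (intro one_less_power prime_gt_1_nat)
  define p :: "'a poly" where "p = monom 1 ?n - [:0, 1:]"
  have deg: "Polynomial.degree p = ?n"
    unfolding p_def diff_conv_add_uminus
    by (subst degree_add_eq_left) (use n in \<open>auto simp: degree_monom_eq\<close>)
  have "of_nat ?n = (0::'a)"
    using assms(2) by (simp add: of_nat_eq_0_iff_char_dvd)
  then have "pderiv p = - 1"
    unfolding p_def using assms(2) by (simp add: pderiv_diff pderiv_monom pderiv_pCons one_pCons power_0_left)
  then have "card {x. poly p x = 0} = Polynomial.degree p"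
    using deg n by (intro card_roots_separable) auto
  then show ?thesis
    by (simp add: deg) (simp add: p_def poly_monom)
qed

section \<open>The truncated Witt graph\<close>

text \<open>
  The vertices of the first factor are the 506 octads of the Steiner system \<open>S(5, 8, 24)\<close> that miss one
  fixed point of the 24, adjacent if they are disjoint; this is the truncated Witt graph. On the
  remaining 23 points, the residues modulo 23, these octads are the words of weight 8 of the binary
  quadratic residue code. The maps \<open>x \<mapsto> u * x + s\<close> with a nonzero square \<open>u\<close> form a group of order 253
  that preserves the code and has two regular orbits on its words of weight 8. The two base octads
  represent these orbits.
\<close>

definition base_octad :: "bool \<Rightarrow> int list" where
  "base_octad k = (if k then [0, 1, 2, 3, 4, 7, 10, 12] else [0, 1, 2, 3, 13, 18, 20, 21])"

definition squares :: "int list" where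
  "squares = [1, 2, 3, 4, 6, 8, 9, 12, 13, 16, 18]"

text \<open>
  Octads are addressed by a base octad together with an element of the group. Indices rather than
  octads are the vertices, so that counting vertices does not require telling octads apart.
\<close>

definition indices :: "(bool \<times> int \<times> int) list" where
  "indices = List.product [True, False] (List.product squares [0..22])"

fun octad :: "bool \<times> int \<times> int \<Rightarrow> int list" where
  "octad (k, u, s) = map (\<lambda>x. (u * x + s) mod 23) (base_octad k)"

abbreviation octad_set :: "bool \<times> int \<times> int \<Rightarrow> int set" where
  "octad_set i \<equiv> set (octad i)"

definition disjoint_lists :: "int list \<Rightarrow> int list \<Rightarrow> bool" where
  "disjoint_lists xs ys \<longleftrightarrow> list_all (\<lambda>x. \<not> List.member ys x) xs"

text \<open>
  Two octads of the Steiner system that are neither equal nor disjoint meet in 2 or 4 points. If they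
  meet in 4 points, then by the sextet structure some octad missing the fixed point is disjoint from
  both. The list \<open>Ns\<close> is meant to hold the octads disjoint from \<open>B\<close>; it is passed as an argument so that
  evaluation computes it only once.
\<close>

definition meets_well :: "int list \<Rightarrow> int list list \<Rightarrow> int list \<Rightarrow> bool" where
  "meets_well B Ns A \<longleftrightarrow>
     length (filter (List.member A) B) \<in> {0, 2} \<or> list_ex (disjoint_lists A) Ns"

text \<open>
  By symmetry it is enough to compare the two base octads with all octads, which is a finite
  computation by rewriting.
\<close>

lemma base_octad_valency:
  "length (filter (disjoint_lists (base_octad True)) (map octad indices)) = 15"
  "length (filter (disjoint_lists (base_octad False)) (map octad indices)) = 15"
  by code_simp+

lemma base_octad_meets_well:
  "list_all (meets_well (base_octad True)
     (filter (disjoint_lists (base_octad True)) (map octad indices))) (map octad indices)"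
  "list_all (meets_well (base_octad False)
     (filter (disjoint_lists (base_octad False)) (map octad indices))) (map octad indices)"
  by code_simp+

lemma disjoint_lists_iff: "disjoint_lists xs ys \<longleftrightarrow> set xs \<inter> set ys = {}"
  by (auto simp: disjoint_lists_def list_all_iff)

lemma set_indices: "set indices = UNIV \<times> set squares \<times> {0..22}"
  by (auto simp: indices_def)

lemma card_indices: "card (set indices) = 506"
  by (simp add: set_indices card_cartesian_product squares_def)

lemma base_index: "(k, 1, 0) \<in> set indices"
  by (simp add: set_indices squares_def)

lemma octad_base: "octad (k, 1, 0) = base_octad k"
  by (simp add: base_octad_def)

lemma octad_set_subset: "octad_set i \<subseteq> {0..22}"
  by (cases i) auto

lemma squares_mult: "u \<in> set squares \<Longrightarrow> w \<in> set squares \<Longrightarrow> u * w mod 23 \<in> set squares"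
  by (auto simp: squares_def)

lemma squares_inverse: "u \<in> set squares \<Longrightarrow> \<exists>w\<in>set squares. w * u mod 23 = 1"
  by (auto simp: squares_def)

lemma squares_range: "u \<in> set squares \<Longrightarrow> u \<in> {0..22}"
  by (auto simp: squares_def)

text \<open>
  A factor \<open>w\<close> is cancelled modulo 23 by multiplying with its inverse.
\<close>

lemma affine_inj:
  assumes "w \<in> set squares" "x \<in> {0..22}" "y \<in> {0..22}"
    and eq: "(w * x + t) mod 23 = (w * y + t) mod (23::int)"
  shows "x = y"
proof -
  obtain v where v: "v * w mod 23 = 1"
    using squares_inverse[OF assms(1)] by blast
  have inv: "((v * w mod 23) * z) mod 23 = z" if "z \<in> {0..22}" for z
    using that v by simp
  have "(w * x) mod 23 = (w * y) mod 23"
    using eq by (metis add_diff_cancel_right' mod_diff_left_eq)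
  then have "(v * (w * x mod 23)) mod 23 = (v * (w * y mod 23)) mod 23"
    by simp
  then have "((v * w mod 23) * x) mod 23 = ((v * w mod 23) * y) mod 23"
    by (simp add: mod_simps mult.assoc)
  then show ?thesis
    using inv assms(2,3) by simp
qed

text \<open>
  The effect on indices of applying \<open>x \<mapsto> w * x + t\<close> to the points of an octad.
\<close>

fun act :: "int \<Rightarrow> int \<Rightarrow> bool \<times> int \<times> int \<Rightarrow> bool \<times> int \<times> int" where
  "act w t (k, u, s) = (k, w * u mod 23, (w * s + t) mod 23)"

lemma octad_set_act: "octad_set (act w t i) = (\<lambda>x. (w * x + t) mod 23) ` octad_set i"
proof (cases i)
  case (fields k u s)
  have "(w * u mod 23 * x + (w * s + t) mod 23) mod 23 = (w * ((u * x + s) mod 23) + t) mod 23" for x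
  proof -
    have "(w * u mod 23 * x + (w * s + t) mod 23) mod 23 = (w * u * x + (w * s + t)) mod 23"
      by (intro mod_add_cong mod_mult_cong) simp_all
    also have "\<dots> = (w * (u * x + s) + t) mod 23"
      by (simp add: algebra_simps)
    also have "\<dots> = (w * ((u * x + s) mod 23) + t) mod 23"
      by (intro mod_add_cong mod_mult_cong) simp_all
    finally show ?thesis .
  qed
  then show ?thesis
    by (simp add: fields image_image)
qed

lemma bij_betw_act:
  assumes w: "w \<in> set squares"
  shows "bij_betw (act w t) (set indices) (set indices)"
  unfolding bij_betw_def
proof
  show inj: "inj_on (act w t) (set indices)"
  proof (rule inj_onI)
    fix i j assume ij: "i \<in> set indices" "j \<in> set indices" "act w t i = act w t j"
    obtain k u s k' u' s' where i: "i = (k, u, s)" and j: "j = (k', u', s')"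
      by (metis prod_cases3)
    have "k = k'" "(w * u + 0) mod 23 = (w * u' + 0) mod 23" "(w * s + t) mod 23 = (w * s' + t) mod 23"
      using ij(3) by (simp_all add: i j)
    moreover have "u \<in> {0..22}" "u' \<in> {0..22}" "s \<in> {0..22}" "s' \<in> {0..22}"
      using ij(1,2) squares_range unfolding i j set_indices by blast+
    ultimately show "i = j"
      using affine_inj[OF w] unfolding i j by blast
  qed
  have "act w t ` set indices \<subseteq> set indices"
    using squares_mult[OF w] by (auto simp: set_indices)
  then show "act w t ` set indices = set indices"
    using inj by (intro endo_inj_surj) auto
qed

lemma octad_set_act_Int:
  assumes "w \<in> set squares"
  shows "octad_set (act w t i) \<inter> octad_set (act w t j)
    = (\<lambda>x. (w * x + t) mod 23) ` (octad_set i \<inter> octad_set j)"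
    and "card (octad_set (act w t i) \<inter> octad_set (act w t j)) = card (octad_set i \<inter> octad_set j)"
proof -
  have inj: "inj_on (\<lambda>x. (w * x + t) mod 23) {0..22}"
    using affine_inj[OF assms] by (intro inj_onI)
  show eq: "octad_set (act w t i) \<inter> octad_set (act w t j)
    = (\<lambda>x. (w * x + t) mod 23) ` (octad_set i \<inter> octad_set j)"
    unfolding octad_set_act using octad_set_subset by (intro inj_on_image_Int[OF inj, symmetric])
  show "card (octad_set (act w t i) \<inter> octad_set (act w t j)) = card (octad_set i \<inter> octad_set j)"
    unfolding eq using octad_set_subset by (intro card_image inj_on_subset[OF inj]) blast
qed

text \<open>
  Every index is moved to a base index by undoing its own affine map. Together with the invariance of
  intersections this carries the computed facts over to all octads.
\<close>

lemma act_to_base: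
  assumes "i \<in> set indices"
  obtains w t k where "w \<in> set squares" "act w t i = (k, 1, 0)"
proof (cases i)
  case (fields k u s)
  then obtain w where w: "w \<in> set squares" "w * u mod 23 = 1"
    using assms squares_inverse by (auto simp: set_indices)
  show ?thesis
    by (rule that[of w "- (w * s)" k]) (use w fields in auto)
qed

definition disjointness :: "(bool \<times> int \<times> int) rel" where
  "disjointness = {(i, j). i \<in> set indices \<and> j \<in> set indices \<and> octad_set i \<inter> octad_set j = {}}"

lemma disjointness_act_iff:
  assumes "w \<in> set squares" "i \<in> set indices" "j \<in> set indices"
  shows "(act w t i, act w t j) \<in> disjointness \<longleftrightarrow> (i, j) \<in> disjointness"
  using assms(2,3) bij_betwE[OF bij_betw_act[OF assms(1)]] octad_set_act_Int(1)[OF assms(1)]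
  by (simp add: disjointness_def)

lemma distinct_indices: "distinct indices"
  unfolding indices_def by (intro distinct_product) (auto simp: squares_def)

lemma card_disjointness_base: "card (disjointness `` {(k, 1, 0)}) = 15"
proof -
  have "disjointness `` {(k, 1, 0)} = set (filter (disjoint_lists (base_octad k) \<circ> octad) indices)"
    using base_index by (auto simp: disjointness_def disjoint_lists_iff octad_base simp del: octad.simps)
  also have "card \<dots> = length (filter (disjoint_lists (base_octad k) \<circ> octad) indices)"
    by (intro distinct_card distinct_filter distinct_indices)
  also have "\<dots> = length (filter (disjoint_lists (base_octad k)) (map octad indices))"
    by (simp add: filter_map)
  also have "\<dots> = 15"
    using base_octad_valency by (cases k) auto
  finally show ?thesis .
qed

lemma card_disjointness_Image:
  assumes "i \<in> set indices"
  shows "card (disjointness `` {i}) = 15"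
proof -
  obtain w t k where w: "w \<in> set squares" "act w t i = (k, 1, 0)"
    using act_to_base[OF assms] .
  note bij = bij_betw_act[OF w(1), of t]
  have "act w t ` (disjointness `` {i}) = disjointness `` {act w t i}"
  proof
    show "act w t ` (disjointness `` {i}) \<subseteq> disjointness `` {act w t i}"
    proof
      fix j assume "j \<in> act w t ` (disjointness `` {i})"
      then obtain j' where "(i, j') \<in> disjointness" "j = act w t j'"
        by blast
      moreover from this have "j' \<in> set indices"
        by (simp add: disjointness_def)
      ultimately show "j \<in> disjointness `` {act w t i}"
        using disjointness_act_iff[OF w(1) assms] by simp
    qed
    show "disjointness `` {act w t i} \<subseteq> act w t ` (disjointness `` {i})"
    proof
      fix j assume j: "j \<in> disjointness `` {act w t i}"
      then have "j \<in> set indices"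
        by (simp add: disjointness_def)
      then obtain j' where "j' \<in> set indices" "j = act w t j'"
        using bij by (metis bij_betw_imp_surj_on imageE)
      then show "j \<in> act w t ` (disjointness `` {i})"
        using j disjointness_act_iff[OF w(1) assms] by auto
    qed
  qed
  moreover have "inj_on (act w t) (disjointness `` {i})"
    by (rule inj_on_subset[OF bij_betw_imp_inj_on[OF bij]]) (auto simp: disjointness_def)
  ultimately show ?thesis
    using card_image card_disjointness_base w(2) by metis
qed

lemma card_octad: "i \<in> set indices \<Longrightarrow> card (octad_set i) = 8"
proof -
  assume i: "i \<in> set indices"
  obtain w t k where w: "w \<in> set squares" "act w t i = (k, 1, 0)"
    using act_to_base[OF i] .
  have "card (set (base_octad k)) = 8"
    by (simp add: base_octad_def)
  then show ?thesis
    using octad_set_act_Int(2)[OF w(1), of t i i] by (simp add: w(2) octad_base del: octad.simps)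
qed

lemma octads_meet_base:
  assumes "j \<in> set indices"
  shows "card (octad_set (k, 1, 0) \<inter> octad_set j) \<in> {0, 2} \<or> ((k, 1, 0), j) \<in> disjointness O disjointness"
proof -
  have "meets_well (base_octad k) (filter (disjoint_lists (base_octad k)) (map octad indices)) (octad j)"
    using base_octad_meets_well assms by (cases k) (auto simp: list_all_iff simp del: octad.simps)
  then consider "length (filter (List.member (octad j)) (base_octad k)) \<in> {0, 2}"
    | n where "n \<in> set indices" "disjoint_lists (base_octad k) (octad n)" "disjoint_lists (octad j) (octad n)"
    by (auto simp: meets_well_def list_ex_iff simp del: octad.simps)
  then show ?thesis
  proof cases
    case 1
    have "distinct (filter (List.member (octad j)) (base_octad k))"
      by (rule distinct_filter) (simp add: base_octad_def)
    then have "card (set (filter (List.member (octad j)) (base_octad k))) \<in> {0, 2}"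
      using 1 by (simp only: distinct_card)
    also have "set (filter (List.member (octad j)) (base_octad k)) = octad_set (k, 1, 0) \<inter> octad_set j"
      by (auto simp: octad_base simp del: octad.simps)
    finally show ?thesis by blast
  next
    case (2 n)
    then have "((k, 1, 0), n) \<in> disjointness" "(n, j) \<in> disjointness"
      using assms base_index by (auto simp: disjointness_def disjoint_lists_iff octad_base simp del: octad.simps)
    then show ?thesis by blast
  qed
qed

lemma octads_meet:
  assumes "i \<in> set indices" "j \<in> set indices" "(i, j) \<notin> disjointness O disjointness"
  shows "card (octad_set i \<inter> octad_set j) \<in> {0, 2}"
proof -
  obtain w t k where w: "w \<in> set squares" "act w t i = (k, 1, 0)"
    using act_to_base[OF assms(1)] .
  note bij = bij_betw_act[OF w(1), of t]
  have "(act w t i, act w t j) \<notin> disjointness O disjointness"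
  proof
    assume "(act w t i, act w t j) \<in> disjointness O disjointness"
    then obtain n where n: "(act w t i, n) \<in> disjointness" "(n, act w t j) \<in> disjointness"
      by blast
    then have "n \<in> set indices"
      by (simp add: disjointness_def)
    then obtain n' where "n' \<in> set indices" "n = act w t n'"
      using bij by (metis bij_betw_imp_surj_on imageE)
    then show False
      using n assms disjointness_act_iff[OF w(1)] by blast
  qed
  then show ?thesis
    using octads_meet_base[of "act w t j" k] bij_betwE[OF bij] assms(2) octad_set_act_Int(2)[OF w(1), of t i j]
    by (simp only: w(2)) blast
qed

lemma sym_disjointness: "sym disjointness"
  by (auto simp: sym_def disjointness_def)

lemma irrefl_disjointness: "irrefl disjointness"
  using card_octad by (fastforce simp: irrefl_def disjointness_def simp del: octad.simps)

lemma finite_disjointness: "finite disjointness"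
  by (rule finite_subset[of _ "set indices \<times> set indices"]) (auto simp: disjointness_def)

lemma card_disjointness: "card disjointness = 7590"
proof -
  have "disjointness = Sigma (set indices) (\<lambda>i. disjointness `` {i})"
    by (auto simp: disjointness_def)
  then have "card disjointness = (\<Sum>i\<in>set indices. card (disjointness `` {i}))"
    using finite_disjointness card_SigmaI[of "set indices" "\<lambda>i. disjointness `` {i}"] by (simp add: finite_Image)
  also have "\<dots> = 7590"
    using card_disjointness_Image card_indices by simp
  finally show ?thesis .
qed

lemma card_disjointness_Image_le: "card (disjointness `` {i}) \<le> 15"
  using card_disjointness_Image[of i]
  by (cases "i \<in> set indices") (auto simp: disjointness_def)

text \<open>
  Let \<open>a\<close>, \<open>b\<close> and \<open>u\<close>, \<open>v\<close> be two pairs of disjoint octads without ends that have a common neighbour.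
  No octad of the first pair is adjacent to one of the second, as then the partner of the former in
  its own pair would be at distance 2 from the latter. Hence all four mixed intersections have exactly
  2 points, and the four octads cover \<open>16 + 16 - 8 = 24\<close> points, but there are only 23.
\<close>

lemma ends_linked_disjointness: "ends_linked disjointness"
  unfolding ends_linked_def
proof (intro allI impI)
  fix a b u v
  assume ab: "(a, b) \<in> disjointness" and uv: "(u, v) \<in> disjointness"
  show "\<exists>x\<in>{a, b}. \<exists>y\<in>{u, v}. (x, y) \<in> disjointness O disjointness"
  proof (rule ccontr)
    assume no: "\<not> ?thesis"
    have two: "card (octad_set x \<inter> octad_set y) = 2" if xy: "x \<in> {a, b}" "y \<in> {u, v}" for x y
    proof -
      have "x \<in> set indices" "y \<in> set indices"
        using xy ab uv by (auto simp: disjointness_def)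
      moreover have "(x, y) \<notin> disjointness"
      proof
        assume "(x, y) \<in> disjointness"
        moreover obtain x' where "x' \<in> {a, b}" "(x', x) \<in> disjointness"
          using xy ab symD[OF sym_disjointness ab] by blast
        ultimately show False
          using no xy by blast
      qed
      ultimately show ?thesis
        using octads_meet[of x y] no xy by (auto simp: disjointness_def simp del: octad.simps)
    qed
    have ind: "a \<in> set indices" "b \<in> set indices" "u \<in> set indices" "v \<in> set indices"
      and disj: "octad_set a \<inter> octad_set b = {}" "octad_set u \<inter> octad_set v = {}"
      using ab uv unfolding disjointness_def by blast+
    let ?A = "octad_set a \<union> octad_set b" and ?U = "octad_set u \<union> octad_set v"
    have A: "card ?A = 16" and U: "card ?U = 16"
      using disj ind by (simp_all only: card_Un_disjoint card_octad finite_set)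
    have "?A \<inter> ?U = ((octad_set a \<inter> octad_set u) \<union> (octad_set a \<inter> octad_set v))
      \<union> ((octad_set b \<inter> octad_set u) \<union> (octad_set b \<inter> octad_set v))"
      by blast
    also have "card \<dots> \<le> (2 + 2) + (2 + 2)"
      by (intro order_trans[OF card_Un_le] add_mono) (use two in auto)
    finally have "card (?A \<inter> ?U) \<le> 8"
      by simp
    moreover have "card (?A \<union> ?U) + card (?A \<inter> ?U) = 32"
      using card_Un_Int[of ?A ?U] A U by simp
    moreover have "card (?A \<union> ?U) \<le> card {0..22::int}"
      using octad_set_subset by (intro card_mono) auto
    ultimately show False
      by simp
  qed
qed

section \<open>Products of powers of 2 and 3\<close>

text \<open>
  Let \<open>\<theta> = m * \<alpha> - n * \<beta>\<close> be positive and small. From \<open>K * \<alpha> + B * \<beta>\<close>, with \<open>B\<close> as large as \<open>x\<close> permits, one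
  reaches the interval below \<open>x\<close> by adding \<open>\<theta>\<close> at most \<open>\<beta> / \<theta>\<close> times, that is by trading \<open>n\<close> copies of \<open>\<beta>\<close>
  for \<open>m\<close> copies of \<open>\<alpha>\<close>. The number of trades is bounded independently of \<open>x\<close>, so the coefficient of
  \<open>\<beta>\<close> stays above \<open>K\<close> once \<open>x\<close> is large.
\<close>

lemma eventually_lattice_point_below:
  fixes \<alpha> \<beta> \<delta> :: real and K m n :: nat
  assumes "\<alpha> > 0" "\<beta> > 0" and \<theta>: "0 < real m * \<alpha> - real n * \<beta>" "real m * \<alpha> - real n * \<beta> < \<delta>"
  shows "\<forall>\<^sub>F x in at_top. \<exists>a\<ge>K. \<exists>b\<ge>K. x - \<delta> < real a * \<alpha> + real b * \<beta> \<and> real a * \<alpha> + real b * \<beta> \<le> x"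
proof -
  define \<theta> where "\<theta> = real m * \<alpha> - real n * \<beta>"
  have "\<theta> > 0" using \<theta> by (simp add: \<theta>_def)
  define J where "J = nat \<lceil>\<beta> / \<theta>\<rceil>"
  define x0 where "x0 = real K * \<alpha> + real (K + J * n) * \<beta>"
  have "\<exists>a\<ge>K. \<exists>b\<ge>K. x - \<delta> < real a * \<alpha> + real b * \<beta> \<and> real a * \<alpha> + real b * \<beta> \<le> x" if "x \<ge> x0" for x
  proof -
    define B where "B = nat \<lfloor>(x - real K * \<alpha>) / \<beta>\<rfloor>"
    have ge: "real (K + J * n) \<le> (x - real K * \<alpha>) / \<beta>"
      using that \<open>\<beta> > 0\<close> by (simp add: x0_def pos_le_divide_eq)
    then have "K + J * n \<le> B"
      unfolding B_def by (simp add: le_nat_floor)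
    have "0 \<le> (x - real K * \<alpha>) / \<beta>"
      using ge by (rule order_trans[rotated]) simp
    then have "real B \<le> (x - real K * \<alpha>) / \<beta>" "(x - real K * \<alpha>) / \<beta> < real B + 1"
      unfolding B_def by (simp_all add: of_nat_floor)
    then have B: "real K * \<alpha> + real B * \<beta> \<le> x" "x < real K * \<alpha> + real B * \<beta> + \<beta>"
      using \<open>\<beta> > 0\<close> by (simp_all add: pos_le_divide_eq pos_divide_less_eq algebra_simps)
    define r where "r = (x - real K * \<alpha> - real B * \<beta>) / \<theta>"
    define j where "j = nat \<lfloor>r\<rfloor>"
    have r: "0 \<le> r" "r < \<beta> / \<theta>"
      using B \<open>\<theta> > 0\<close> by (simp_all add: r_def divide_strict_right_mono)
    have j: "real j \<le> r" "r < real j + 1"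
      using r(1) unfolding j_def by (simp_all add: of_nat_floor)
    have "j \<le> J"
      unfolding j_def J_def using r(2) by (intro nat_mono) linarith
    then have "j * n \<le> J * n"
      by (rule mult_le_mono1)
    then have "K + j * n \<le> B"
      using \<open>K + J * n \<le> B\<close> by linarith
    then have b: "K \<le> B - j * n" "real (B - j * n) = real B - real j * real n"
      by (simp_all add: of_nat_diff)
    have "real (K + j * m) * \<alpha> + real (B - j * n) * \<beta> = real K * \<alpha> + real B * \<beta> + real j * \<theta>"
      unfolding b(2) \<theta>_def by (simp add: algebra_simps)
    moreover have "real j * \<theta> \<le> x - real K * \<alpha> - real B * \<beta>" "x - real K * \<alpha> - real B * \<beta> < real j * \<theta> + \<theta>"
      using j \<open>\<theta> > 0\<close> unfolding r_def by (simp_all add: pos_le_divide_eq pos_divide_less_eq algebra_simps)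
    ultimately show ?thesis
      using b(1) \<theta>(2) by (intro exI[of _ "K + j * m"] exI[of _ "B - j * n"] conjI) (auto simp: \<theta>_def)
  qed
  then show ?thesis
    unfolding eventually_at_top_linorder by blast
qed

text \<open>
  Dirichlet approximation of \<open>ln 2 / ln 3\<close>; the combination does not vanish because a positive power of 2
  is even and a power of 3 is odd. Its sign is not known, which is why the previous lemma is used with
  either logarithm in the role of \<open>\<alpha>\<close>.
\<close>

lemma small_combination_ln_2_ln_3:
  fixes \<delta> :: real
  assumes "\<delta> > 0"
  shows "\<exists>m n. \<bar>real m * ln 2 - real n * ln 3\<bar> < \<delta> \<and> real m * ln 2 \<noteq> real n * ln 3"
proof -
  obtain N :: nat where N: "N > 0" "ln 3 / \<delta> < real N"
    using reals_Archimedean2[of "max 1 (ln 3 / \<delta>)"] by (metis max_less_iff_conj of_nat_0_less_iff less_trans zero_less_one)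
  obtain h k where hk: "0 < k" "\<bar>of_int k * (ln 2 / ln 3) - of_int h\<bar> < 1 / real N"
    using Dirichlet_approx[OF N(1)] by metis
  have "0 < of_int k * (ln 2 / ln 3 :: real)"
    using hk(1) by simp
  moreover have "1 / real N \<le> 1"
    using N(1) by simp
  ultimately have "h > - 1"
    using hk(2) by linarith
  then obtain p q where pq: "k = int p" "h = int q"
    using hk(1) that[of "nat k" "nat h"] by simp
  have "\<bar>real p * ln 2 - real q * ln 3\<bar> / ln 3 = \<bar>(real p * ln 2 - real q * ln 3) / ln 3\<bar>"
    by (simp add: abs_divide)
  also have "\<dots> = \<bar>real p * (ln 2 / ln 3) - real q\<bar>"
    by (simp add: diff_divide_distrib)
  also have "\<dots> < 1 / real N"
    using hk(2) by (simp add: pq)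
  finally have "\<bar>real p * ln 2 - real q * ln 3\<bar> / ln 3 < 1 / real N" .
  moreover have "ln 3 / real N < \<delta>"
    using N assms by (simp add: field_simps)
  ultimately have "\<bar>real p * ln 2 - real q * ln 3\<bar> < \<delta>"
    by (simp add: pos_divide_less_eq)
  moreover have "real p * ln 2 \<noteq> real q * ln 3"
  proof
    assume "real p * ln 2 = real q * ln 3"
    then have "ln (2 ^ p :: real) = ln (3 ^ q)"
      by (simp add: ln_realpow)
    then have "(2 ^ p :: real) = 3 ^ q"
      by (metis exp_ln zero_less_numeral zero_less_power)
    then have "real (2 ^ p) = real (3 ^ q)"
      by simp
    then have "(2 ^ p :: nat) = 3 ^ q"
      by (simp only: of_nat_eq_iff)
    moreover have "even (2 ^ p :: nat)" "odd (3 ^ q :: nat)"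
      using hk(1) by (simp_all add: pq)
    ultimately show False
      by simp
  qed
  ultimately show ?thesis
    by blast
qed

text \<open>
  The products \<open>2 ^ a * 3 ^ b\<close> with large exponents become dense on a multiplicative scale. This replaces
  the distribution of primes, which would be needed if only planes of prime order were used.
\<close>

lemma eventually_2_3_smooth_below:
  fixes c :: real and K :: nat
  assumes "0 < c" "c < 1"
  shows "\<forall>\<^sub>F Y in at_top. \<exists>a\<ge>K. \<exists>b\<ge>K. c * Y < 2 ^ a * 3 ^ b \<and> 2 ^ a * 3 ^ b \<le> Y"
proof -
  define \<delta> where "\<delta> = - ln c"
  have "\<delta> > 0"
    using assms by (simp add: \<delta>_def)
  obtain m n where mn: "\<bar>real m * ln 2 - real n * ln 3\<bar> < \<delta>" "real m * ln 2 \<noteq> real n * ln 3"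
    using small_combination_ln_2_ln_3[OF \<open>\<delta> > 0\<close>] by blast
  have "\<forall>\<^sub>F x in at_top. \<exists>a\<ge>K. \<exists>b\<ge>K. x - \<delta> < real a * ln 2 + real b * ln 3 \<and> real a * ln 2 + real b * ln 3 \<le> x"
  proof (cases "real m * ln 2 > real n * ln 3")
    case True
    then show ?thesis
      using eventually_lattice_point_below[of "ln 2" "ln 3" m n \<delta> K] mn by simp
  next
    case False
    then have "\<forall>\<^sub>F x in at_top. \<exists>b\<ge>K. \<exists>a\<ge>K. x - \<delta> < real b * ln 3 + real a * ln 2 \<and> real b * ln 3 + real a * ln 2 \<le> x"
      using mn by (intro eventually_lattice_point_below[of "ln 3" "ln 2" n m \<delta> K]) auto
    then show ?thesis
      by (rule eventually_mono) (metis add.commute)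
  qed
  then have "\<forall>\<^sub>F Y in at_top. \<exists>a\<ge>K. \<exists>b\<ge>K. ln Y - \<delta> < real a * ln 2 + real b * ln 3 \<and> real a * ln 2 + real b * ln 3 \<le> ln (Y::real)"
    using ln_at_top by (rule eventually_compose_filterlim)
  with eventually_gt_at_top[of 0] show ?thesis
  proof eventually_elim
    case (elim Y)
    then obtain a b where ab: "a \<ge> K" "b \<ge> K" "ln Y - \<delta> < real a * ln 2 + real b * ln 3"
        "real a * ln 2 + real b * ln 3 \<le> ln Y"
      by blast
    have "real a * ln 2 + real b * ln 3 = ln (2 ^ a * 3 ^ b :: real)"
      by (simp add: ln_mult ln_realpow)
    moreover have "ln Y - \<delta> = ln (c * Y)"
      using assms elim by (simp add: ln_mult \<delta>_def)
    ultimately have "c * Y < 2 ^ a * 3 ^ b" "2 ^ a * 3 ^ b \<le> Y"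
      using ab(3,4) assms elim by simp_all
    with ab show ?case
      by blast
  qed
qed

section \<open>The asymptotic lower bound\<close>

lemma exists_polarity:
  assumes "prime CHAR('a::alg_closed_field)" "k > 0"
  shows "\<exists>S :: 'a point rel. finite S \<and> sym S \<and> all_linked S \<and>
    (\<forall>p. card (S `` {p}) \<le> CHAR('a) ^ k + 1) \<and> (CHAR('a) ^ k) ^ 3 \<le> card S"
proof -
  define F where "F = {x::'a. x ^ CHAR('a) ^ k = x}"
  have F: "subfield_set F" "card F = CHAR('a) ^ k"
    unfolding F_def using assms subfield_set_frobenius_fixed card_frobenius_fixed by blast+
  have "finite F"
    using F(2) assms by (intro card_ge_0_finite) (simp add: prime_gt_0_nat)
  show ?thesis
    using finite_polarity[OF \<open>finite F\<close>] sym_polarity all_linked_polarity[OF F(1)]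
      card_polarity_Image_le[OF F(1) \<open>finite F\<close>] card_polarity_ge[OF F(1) \<open>finite F\<close>] F(2)
    by (intro exI[of _ "polarity F"]) simp
qed

lemma CHAR_finite_2: "CHAR(Enum.finite_2) = 2"
  by (rule CHAR_eq_posI) (auto simp: less_Suc_eq numeral_2_eq_2 plus_finite_2_def)

lemma CHAR_finite_3: "CHAR(Enum.finite_3) = 3"
  by (rule CHAR_eq_posI) (auto simp: less_Suc_eq numeral_3_eq_3 plus_finite_3_def times_finite_3_def)

text \<open>
  Tensoring the graph on the octads with the polarity graphs of orders \<open>2 ^ a\<close> and \<open>3 ^ b\<close>. The constant is
  \<open>3795 = 506 * 15 / 2\<close>, the number of edges of the truncated Witt graph.
\<close>

lemma h_3_gt:
  assumes "a > 0" "b > 0" and D: "15 * ((2 ^ a + 1) * (3 ^ b + 1)) \<le> D"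
  shows "3795 * (2 ^ a * 3 ^ b) ^ 3 < h 3 D"
proof -
  obtain S :: "Enum.finite_2 alg_closure point rel" where S: "finite S" "sym S" "all_linked S"
    "\<And>p. card (S `` {p}) \<le> 2 ^ a + 1" "(2 ^ a) ^ 3 \<le> card S"
    using exists_polarity[where 'a = "Enum.finite_2 alg_closure", OF _ \<open>a > 0\<close>] by (auto simp: CHAR_finite_2)
  obtain T :: "Enum.finite_3 alg_closure point rel" where T: "finite T" "sym T" "all_linked T"
    "\<And>p. card (T `` {p}) \<le> 3 ^ b + 1" "(3 ^ b) ^ 3 \<le> card T"
    using exists_polarity[where 'a = "Enum.finite_3 alg_closure", OF _ \<open>b > 0\<close>] by (auto simp: CHAR_finite_3)
  let ?R = "tensor disjointness (tensor S T)"
  have "card (?R `` {v}) \<le> D" for v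
    using S(4) T(4) card_disjointness_Image_le
    by (intro order_trans[OF _ D] card_tensor_Image_le)
  then have "card ?R < 2 * h 3 D"
    using S(1-3) T(1-3)
    by (intro card_less_2_h_3 finite_tensor sym_tensor irrefl_tensor ends_linked_tensor all_linked_tensor
        finite_disjointness sym_disjointness irrefl_disjointness ends_linked_disjointness)
  moreover have "7590 * ((2 ^ a) ^ 3 * (3 ^ b) ^ 3) \<le> card ?R"
    unfolding card_tensor card_disjointness using S(5) T(5) by (intro mult_le_mono) auto
  ultimately show ?thesis
    by (simp add: power_mult_distrib)
qed

text \<open>
  Both losses, that of \<open>(2 ^ a + 1) * (3 ^ b + 1)\<close> against \<open>2 ^ a * 3 ^ b\<close> and that from the gaps between the
  numbers \<open>2 ^ a * 3 ^ b\<close>, are bounded by a factor \<open>g < 1\<close> as close to 1 as desired. So \<open>2 ^ a * 3 ^ b\<close> may be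
  taken larger than \<open>g\<^sup>2 * D / 15\<close>, and \<open>3795 / 15 ^ 3 = 253 / 225\<close>.
\<close>

lemma eventually_h_3_gt:
  fixes c :: real
  assumes "c < 253 / 225"
  shows "\<forall>\<^sub>F D in sequentially. c * real D ^ 3 < real (h 3 D)"
proof -
  have "((\<lambda>g::real. 253 / 225 * g ^ 6) \<longlongrightarrow> 253 / 225 * 1 ^ 6) (at_left 1)"
    by (intro tendsto_intros)
  then have "\<forall>\<^sub>F g in at_left 1. c < 253 / 225 * g ^ 6"
    using assms by (intro order_tendstoD(1)) auto
  moreover have "\<forall>\<^sub>F g in at_left 1. g \<in> {0<..<1::real}"
    by (rule eventually_at_left_real) simp
  ultimately have "\<forall>\<^sub>F g in at_left 1. c < 253 / 225 * g ^ 6 \<and> g \<in> {0<..<1::real}"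
    by eventually_elim blast
  then obtain g :: real where g: "c < 253 / 225 * g ^ 6" "0 < g" "g < 1"
    using eventually_happens[of _ "at_left (1::real)"] by fastforce
  have "(\<lambda>K. (1 + (1 / 2) ^ K) ^ 2) \<longlonglongrightarrow> (1 + 0 :: real) ^ 2"
    by (intro tendsto_intros LIMSEQ_power_zero) simp
  then have "\<forall>\<^sub>F K in sequentially. (1 + (1 / 2) ^ K) ^ 2 < 1 / g"
    using g by (intro order_tendstoD(2)) auto
  then obtain K where K: "(1 + (1 / 2) ^ K) ^ 2 < 1 / g" "K > 0"
    using eventually_happens[OF eventually_conj[OF _ eventually_gt_at_top[of 0]]] by fastforce
  have "\<forall>\<^sub>F D in sequentially. \<exists>a\<ge>K. \<exists>b\<ge>K. g * (g * real D / 15) < 2 ^ a * 3 ^ b \<and> 2 ^ a * 3 ^ b \<le> g * real D / 15"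
  proof (rule eventually_compose_filterlim[OF eventually_2_3_smooth_below[OF g(2,3), of K]])
    show "filterlim (\<lambda>D. g * real D / 15) at_top sequentially"
      using g(2) by real_asymp
  qed
  then show ?thesis
    using eventually_gt_at_top[of 0]
  proof eventually_elim
    case (elim D)
    then obtain a b where ab: "a \<ge> K" "b \<ge> K" "g * (g * real D / 15) < 2 ^ a * 3 ^ b" "2 ^ a * 3 ^ b \<le> g * real D / 15"
      by blast
    let ?d = "1 + (1 / 2) ^ K :: real"
    have "(1 / 2) ^ a \<le> (1 / 2 :: real) ^ K" "(1 / 3) ^ b \<le> (1 / 3 :: real) ^ K" "(1 / 3 :: real) ^ K \<le> (1 / 2) ^ K"
      using ab by (auto intro!: power_decreasing power_mono)
    then have "1 + (1 / 2) ^ a \<le> ?d" "1 + (1 / 3) ^ b \<le> ?d"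
      by linarith+
    then have "(2 ^ a * (1 + (1 / 2) ^ a)) * (3 ^ b * (1 + (1 / 3) ^ b)) \<le> (2 ^ a * ?d) * (3 ^ b * ?d)"
      by (intro mult_mono) auto
    moreover have "2 ^ a * (1 + (1 / 2) ^ a) = (2 ^ a + 1 :: real)" "3 ^ b * (1 + (1 / 3) ^ b) = (3 ^ b + 1 :: real)"
      by (simp_all add: distrib_left flip: power_mult_distrib)
    moreover have "(2 ^ a * ?d) * (3 ^ b * ?d) = (2 ^ a * 3 ^ b) * ?d ^ 2"
      by (simp only: power2_eq_square mult_ac)
    ultimately have "(2 ^ a + 1) * (3 ^ b + 1) \<le> (2 ^ a * 3 ^ b) * ?d ^ 2"
      by (simp only:)
    also have "\<dots> \<le> (g * real D / 15) * (1 / g)"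
      using ab(4) K(1) g(2) by (intro mult_mono) auto
    also have "\<dots> = real D / 15"
      using g(2) by simp
    finally have "15 * ((2 ^ a + 1) * (3 ^ b + 1)) \<le> real D"
      by linarith
    then have "real (15 * ((2 ^ a + 1) * (3 ^ b + 1))) \<le> real D"
      by (simp add: algebra_simps)
    then have "3795 * (2 ^ a * 3 ^ b) ^ 3 < h 3 D"
      using ab K(2) by (intro h_3_gt) (simp_all only: of_nat_le_iff)
    then have "real (3795 * (2 ^ a * 3 ^ b) ^ 3) < real (h 3 D)"
      by (simp only: of_nat_less_iff)
    moreover have "c * real D ^ 3 \<le> 253 / 225 * g ^ 6 * real D ^ 3"
      using g(1) by (intro mult_right_mono) auto
    moreover have "253 / 225 * g ^ 6 * real D ^ 3 = 3795 * (g * (g * real D / 15)) ^ 3"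
      by (simp add: power_mult_distrib power_divide flip: power_mult power_add)
    moreover have "3795 * (g * (g * real D / 15)) ^ 3 \<le> 3795 * (2 ^ a * 3 ^ b) ^ 3"
      using ab(3) g(2) by (intro mult_left_mono power_mono) auto
    ultimately show ?case
      by simp
  qed
qed

theorem theorem1p11:
  "liminf (\<lambda>D. ereal (real (h 3 D) / real D ^ 3)) \<ge> ereal (253 / 225)
   \<and> (\<forall>\<epsilon>::real. 0 < \<epsilon> \<and> \<epsilon> < 28 / 225 \<longrightarrow>
        (\<exists>D0. \<forall>D\<ge>D0. real (h 3 D) > (1 + \<epsilon>) * real D ^ 3))"
proof (intro conjI allI impI)
  have "\<forall>\<^sub>F D in sequentially. y < ereal (real (h 3 D) / real D ^ 3)" if y: "y < ereal (253 / 225)" for y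
  proof -
    obtain c where c: "y < ereal c" "c < 253 / 225"
      using ereal_dense2[OF y] by auto
    have "\<forall>\<^sub>F D in sequentially. c * real D ^ 3 < real (h 3 D)"
      by (rule eventually_h_3_gt[OF c(2)])
    with eventually_gt_at_top[of 0] show ?thesis
    proof eventually_elim
      case (elim D)
      then have "c < real (h 3 D) / real D ^ 3"
        by (simp add: pos_less_divide_eq)
      then show ?case
        using c(1) by (meson ereal_less(2) less_ereal.simps(1) less_trans)
    qed
  qed
  then show "liminf (\<lambda>D. ereal (real (h 3 D) / real D ^ 3)) \<ge> ereal (253 / 225)"
    by (simp add: le_Liminf_iff)
next
  fix \<epsilon> :: real
  assume "0 < \<epsilon> \<and> \<epsilon> < 28 / 225"
  then show "\<exists>D0. \<forall>D\<ge>D0. real (h 3 D) > (1 + \<epsilon>) * real D ^ 3"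
    using eventually_h_3_gt[of "1 + \<epsilon>"] by (simp add: eventually_sequentially)
qed

end
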